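(* Let $N\geq 2$, $1<p<N$, and let $\Omega\subset\mathbb{R}^N$ be a bounded and smooth domain. Let $p^\star:=\frac{Np}{N-p}$ and, for $1\leq q\leq p^\star$, let $$\lambda_q:=\inf\left\{\frac{\|\nabla u\|_{p}^p}{\|u\|_{q}^p}: u\in W_0^{1,p}(\Omega)\setminus\{0\}\right\}.$$ Then the function $q\mapsto\lambda_q$ is of bounded variation in $[1,p^\star]$.
   Context: $\|\cdot\|_s:=\left(\int_\Omega|\cdot|^s\,dx\right)^{1/s}$ denotes the usual norm of $L^s(\Omega)$, and $W_0^{1,p}(\Omega)$ is the usual Sobolev space (closure of $C_c^\infty(\Omega)$ in $W^{1,p}(\Omega)$). *)

theory Defs
  imports "HOL-Analysis.Analysis"
begin

text \<open>Functions on \<open>\<Omega>\<close> are represented by total functions whose values outside \<open>\<Omega>\<close> are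
  ignored, except in \<open>C_smooth\<close> and \<open>test_fun\<close>, which speak about functions on the whole space.\<close>

primrec C_k :: "nat \<Rightarrow> ('a::euclidean_space \<Rightarrow> real) \<Rightarrow> bool" where
  "C_k 0 f \<longleftrightarrow> continuous_on UNIV f"
| "C_k (Suc k) f \<longleftrightarrow> (\<forall>x. f differentiable (at x)) \<and>
     (\<forall>i\<in>Basis. C_k k (\<lambda>x. frechet_derivative f (at x) i))"

definition C_smooth :: "('a::euclidean_space \<Rightarrow> real) \<Rightarrow> bool" where
  "C_smooth f \<longleftrightarrow> (\<forall>k. C_k k f)"

text \<open>Near each boundary point the domain is, after a choice of the vertical direction \<open>e\<close>, the
  part above the graph of a smooth function \<open>\<gamma>\<close> of the remaining \<open>DIM('a) - 1\<close> coordinates.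
  The point \<open>x - (x \<bullet> e) *\<^sub>R e\<close> is the projection of \<open>x\<close> to the hyperplane orthogonal to \<open>e\<close>;
  only the values of \<open>\<gamma>\<close> on that hyperplane matter.\<close>

definition smooth_boundary :: "'a::euclidean_space set \<Rightarrow> bool" where
  "smooth_boundary \<Omega> \<longleftrightarrow>
     (\<forall>x0\<in>frontier \<Omega>. \<exists>r>0. \<exists>e \<gamma>. norm e = 1 \<and> C_smooth \<gamma> \<and>
        \<Omega> \<inter> ball x0 r = {x \<in> ball x0 r. \<gamma> (x - (x \<bullet> e) *\<^sub>R e) < x \<bullet> e})"

definition smooth_bounded_domain :: "'a::euclidean_space set \<Rightarrow> bool" where
  "smooth_bounded_domain \<Omega> \<longleftrightarrow>
     open \<Omega> \<and> connected \<Omega> \<and> \<Omega> \<noteq> {} \<and> bounded \<Omega> \<and> smooth_boundary \<Omega>"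

definition test_fun :: "'a::euclidean_space set \<Rightarrow> ('a \<Rightarrow> real) set" where
  "test_fun \<Omega> = {\<phi>. C_smooth \<phi> \<and> compact (closure {x. \<phi> x \<noteq> 0}) \<and> closure {x. \<phi> x \<noteq> 0} \<subseteq> \<Omega>}"

definition Lp_space :: "real \<Rightarrow> 'a::euclidean_space set \<Rightarrow> ('a \<Rightarrow> 'b::euclidean_space) set" where
  "Lp_space s \<Omega> = {f \<in> borel_measurable (lebesgue_on \<Omega>).
     integrable (lebesgue_on \<Omega>) (\<lambda>x. norm (f x) powr s)}"

text \<open>This is the usual norm for \<open>f \<in> Lp_space s \<Omega>\<close>; it takes the value \<open>0\<close> if the integral
  is infinite.\<close>

definition Lp_norm :: "real \<Rightarrow> 'a::euclidean_space set \<Rightarrow> ('a \<Rightarrow> 'b::euclidean_space) \<Rightarrow> real" where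
  "Lp_norm s \<Omega> f = (\<integral>x. norm (f x) powr s \<partial>lebesgue_on \<Omega>) powr (1 / s)"

definition locally_integrable ::
    "'a::euclidean_space set \<Rightarrow> ('a \<Rightarrow> 'b::euclidean_space) \<Rightarrow> bool" where
  "locally_integrable \<Omega> f \<longleftrightarrow> (\<forall>K. compact K \<and> K \<subseteq> \<Omega> \<longrightarrow> integrable (lebesgue_on K) f)"

definition has_weak_gradient :: "'a::euclidean_space set \<Rightarrow> ('a \<Rightarrow> real) \<Rightarrow> ('a \<Rightarrow> 'a) \<Rightarrow> bool" where
  "has_weak_gradient \<Omega> u g \<longleftrightarrow> locally_integrable \<Omega> u \<and> locally_integrable \<Omega> g \<and>
     (\<forall>\<phi>\<in>test_fun \<Omega>. \<forall>i\<in>Basis.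
        (\<integral>x. u x * frechet_derivative \<phi> (at x) i \<partial>lebesgue_on \<Omega>) =
        - (\<integral>x. (g x \<bullet> i) * \<phi> x \<partial>lebesgue_on \<Omega>))"

text \<open>For open \<open>\<Omega>\<close>, the weak gradient is determined up to a null set; an arbitrary representative
  is chosen here.\<close>

definition weak_gradient :: "'a::euclidean_space set \<Rightarrow> ('a \<Rightarrow> real) \<Rightarrow> 'a \<Rightarrow> 'a" where
  "weak_gradient \<Omega> u = (SOME g. has_weak_gradient \<Omega> u g)"

definition W1p :: "real \<Rightarrow> 'a::euclidean_space set \<Rightarrow> ('a \<Rightarrow> real) set" where
  "W1p p \<Omega> = {u \<in> Lp_space p \<Omega>. \<exists>g \<in> Lp_space p \<Omega>. has_weak_gradient \<Omega> u g}"

definition W1p_norm :: "real \<Rightarrow> 'a::euclidean_space set \<Rightarrow> ('a \<Rightarrow> real) \<Rightarrow> real" where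
  "W1p_norm p \<Omega> u =
     (Lp_norm p \<Omega> u powr p + Lp_norm p \<Omega> (weak_gradient \<Omega> u) powr p) powr (1 / p)"

definition W01p :: "real \<Rightarrow> 'a::euclidean_space set \<Rightarrow> ('a \<Rightarrow> real) set" where
  "W01p p \<Omega> = {u \<in> W1p p \<Omega>. \<exists>\<phi>. (\<forall>n. \<phi> n \<in> test_fun \<Omega>) \<and>
     (\<lambda>n. W1p_norm p \<Omega> (\<lambda>x. u x - \<phi> n x)) \<longlonglongrightarrow> 0}"

text \<open>Elements of Sobolev spaces are identified when they agree almost everywhere, so removing
  \<open>0\<close> means removing every function that vanishes almost everywhere in \<open>\<Omega>\<close>. The Sobolev
  embedding makes \<open>Lp_norm q \<Omega> u\<close> the genuine norm of \<open>u\<close> for all \<open>1 \<le> q \<le> DIM('a) * p / (DIM('a) - p)\<close>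
  when \<open>\<Omega>\<close> is bounded and open and \<open>1 < p < DIM('a)\<close>.\<close>

definition sobolev_const :: "real \<Rightarrow> 'a::euclidean_space set \<Rightarrow> real \<Rightarrow> real" where
  "sobolev_const p \<Omega> q =
     (INF u \<in> {u \<in> W01p p \<Omega>. \<not> (AE x in lebesgue_on \<Omega>. u x = 0)}.
        Lp_norm p \<Omega> (weak_gradient \<Omega> u) powr p / Lp_norm q \<Omega> u powr p)"

definition bounded_variation_on :: "(real \<Rightarrow> real) \<Rightarrow> real set \<Rightarrow> bool" where
  "bounded_variation_on f S \<longleftrightarrow>
     (\<exists>M. \<forall>n t. (\<forall>i\<le>n. t i \<in> S) \<and> (\<forall>i<n. t i \<le> t (Suc i)) \<longrightarrow>
        (\<Sum>i<n. \<bar>f (t (Suc i)) - f (t i)\<bar>) \<le> M)"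

end

theory Submission
  imports Defs
begin

text \<open>Put \<open>m = |\<Omega>|\<close>. On the finite measure space \<open>\<Omega>\<close> the normalised norm
  \<open>m powr (- 1 / q) * \<parallel>u\<parallel>\<^sub>q\<close> increases with \<open>q\<close> (\<open>power_mean_mono\<close>), so every
  quotient \<open>m powr (p / q) * \<parallel>\<nabla>u\<parallel>\<^sub>p\<^sup>p / \<parallel>u\<parallel>\<^sub>q\<^sup>p\<close> decreases with \<open>q\<close>, and hence so
  does its infimum over \<open>u\<close>, which is \<open>m powr (p / q) * \<lambda>\<^sub>q\<close> (\<open>sobolev_const_rescaled_antimono\<close>).
  Therefore \<open>\<lambda>\<^sub>q\<close> is the product of this monotone function with the monotone function
  \<open>m powr (- p / q)\<close>, and products of functions of bounded variation have bounded
  variation (\<open>bounded_variation_on_mult\<close>).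

  The comparison of quotients also covers a function \<open>u\<close> with \<open>\<parallel>u\<parallel>\<^sub>q = \<infinity>\<close>: its quotient at \<open>q\<close>
  has the value \<open>0\<close>, in agreement with the limiting value of the quotient as the norm of \<open>u\<close>
  grows, so the quotients still decrease.\<close>

section \<open>Functions of bounded variation\<close>

lemma bounded_variation_on_imp_bounded:
  assumes "bounded_variation_on f S"
  shows "\<exists>B\<ge>0. \<forall>x\<in>S. \<bar>f x\<bar> \<le> B"
proof (cases "S = {}")
  case False
  then obtain c where c: "c \<in> S" by blast
  obtain M where M: "\<And>n t. (\<forall>i\<le>n. t i \<in> S) \<Longrightarrow> (\<forall>i<n. t i \<le> t (Suc i)) \<Longrightarrow>
      (\<Sum>i<n. \<bar>f (t (Suc i)) - f (t i)\<bar>) \<le> M"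
    using assms unfolding bounded_variation_on_def by blast
  have "\<bar>f x\<bar> \<le> \<bar>f c\<bar> + \<bar>M\<bar>" if "x \<in> S" for x
  proof -
    \<comment> \<open>The partition consists of the two points \<open>c\<close> and \<open>x\<close>.\<close>
    have "\<forall>i\<le>1. (if i = 0 then min c x else max c x) \<in> S"
      using that c by (auto simp: min_def max_def)
    from M[OF this] have "\<bar>f (max c x) - f (min c x)\<bar> \<le> M"
      by simp
    then show ?thesis
      by (auto simp: min_def max_def split: if_splits)
  qed
  then show ?thesis
    by (intro exI[of _ "\<bar>f c\<bar> + \<bar>M\<bar>"]) auto
qed auto

lemma bounded_variation_on_mult:
  assumes "bounded_variation_on f S" and "bounded_variation_on g S"
  shows "bounded_variation_on (\<lambda>x. f x * g x) S"
proof -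
  obtain A B where A: "A \<ge> 0" "\<And>x. x \<in> S \<Longrightarrow> \<bar>f x\<bar> \<le> A"
    and B: "B \<ge> 0" "\<And>x. x \<in> S \<Longrightarrow> \<bar>g x\<bar> \<le> B"
    using assms bounded_variation_on_imp_bounded by meson
  obtain F where F: "\<And>n t. (\<forall>i\<le>n. t i \<in> S) \<Longrightarrow> (\<forall>i<n. t i \<le> t (Suc i)) \<Longrightarrow>
      (\<Sum>i<n. \<bar>f (t (Suc i)) - f (t i)\<bar>) \<le> F"
    using assms(1) unfolding bounded_variation_on_def by blast
  obtain G where G: "\<And>n t. (\<forall>i\<le>n. t i \<in> S) \<Longrightarrow> (\<forall>i<n. t i \<le> t (Suc i)) \<Longrightarrow>
      (\<Sum>i<n. \<bar>g (t (Suc i)) - g (t i)\<bar>) \<le> G"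
    using assms(2) unfolding bounded_variation_on_def by blast
  have step: "\<bar>f y * g y - f x * g x\<bar> \<le> A * \<bar>g y - g x\<bar> + B * \<bar>f y - f x\<bar>"
    if "x \<in> S" "y \<in> S" for x y
  proof -
    have "f y * g y - f x * g x = f y * (g y - g x) + g x * (f y - f x)"
      by (simp add: algebra_simps)
    then have "\<bar>f y * g y - f x * g x\<bar> \<le> \<bar>f y\<bar> * \<bar>g y - g x\<bar> + \<bar>g x\<bar> * \<bar>f y - f x\<bar>"
      by (metis abs_mult abs_triangle_ineq)
    also have "\<dots> \<le> A * \<bar>g y - g x\<bar> + B * \<bar>f y - f x\<bar>"
      using that A B by (intro add_mono mult_right_mono) auto
    finally show ?thesis .
  qed
  have "(\<Sum>i<n. \<bar>f (t (Suc i)) * g (t (Suc i)) - f (t i) * g (t i)\<bar>) \<le> A * G + B * F"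
    if t: "\<forall>i\<le>n. t i \<in> S" "\<forall>i<n. t i \<le> t (Suc i)" for n t
  proof -
    have "(\<Sum>i<n. \<bar>f (t (Suc i)) * g (t (Suc i)) - f (t i) * g (t i)\<bar>)
        \<le> (\<Sum>i<n. A * \<bar>g (t (Suc i)) - g (t i)\<bar> + B * \<bar>f (t (Suc i)) - f (t i)\<bar>)"
      using t by (intro sum_mono step) auto
    also have "\<dots> = A * (\<Sum>i<n. \<bar>g (t (Suc i)) - g (t i)\<bar>) + B * (\<Sum>i<n. \<bar>f (t (Suc i)) - f (t i)\<bar>)"
      by (simp add: sum.distrib sum_distrib_left)
    also have "\<dots> \<le> A * G + B * F"
      using F[OF t] G[OF t] A(1) B(1) by (intro add_mono mult_left_mono) auto
    finally show ?thesis .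
  qed
  then show ?thesis
    unfolding bounded_variation_on_def by blast
qed

lemma mono_on_imp_bounded_variation_on:
  fixes f :: "real \<Rightarrow> real"
  assumes "mono_on {a..b} f"
  shows "bounded_variation_on f {a..b}"
  unfolding bounded_variation_on_def
proof (intro exI allI impI)
  fix n and t :: "nat \<Rightarrow> real"
  assume "(\<forall>i\<le>n. t i \<in> {a..b}) \<and> (\<forall>i<n. t i \<le> t (Suc i))"
  then have t: "\<And>i. i \<le> n \<Longrightarrow> t i \<in> {a..b}" "\<And>i. i < n \<Longrightarrow> t i \<le> t (Suc i)"
    by auto
  have "(\<Sum>i<n. \<bar>f (t (Suc i)) - f (t i)\<bar>) = (\<Sum>i<n. f (t (Suc i)) - f (t i))"
    using t by (intro sum.cong refl abs_of_nonneg) (auto intro!: mono_onD[OF assms])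
  also have "\<dots> = f (t n) - f (t 0)"
    by (rule sum_lessThan_telescope)
  also have "\<dots> \<le> f b - f a"
    using t(1)[of n] t(1)[of 0] by (intro diff_mono mono_onD[OF assms]) auto
  finally show "(\<Sum>i<n. \<bar>f (t (Suc i)) - f (t i)\<bar>) \<le> f b - f a" .
qed

lemma antimono_on_imp_bounded_variation_on:
  fixes f :: "real \<Rightarrow> real"
  assumes "antimono_on {a..b} f"
  shows "bounded_variation_on f {a..b}"
proof -
  have "mono_on {a..b} (\<lambda>x. - f x)"
    using assms by (auto simp: monotone_on_def)
  from mono_on_imp_bounded_variation_on[OF this] show ?thesis
    by (simp add: bounded_variation_on_def abs_minus_commute)
qed

lemma bounded_variation_on_powr_inverse:
  fixes m c :: real
  assumes "0 < m" and "0 \<le> c" and "0 < a"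
  shows "bounded_variation_on (\<lambda>q. m powr (- (c / q))) {a..b}"
proof (cases "m \<ge> 1")
  case True
  then have "mono_on {a..b} (\<lambda>q. m powr (- (c / q)))"
    using assms by (auto intro!: monotone_onI powr_mono divide_left_mono)
  then show ?thesis
    by (rule mono_on_imp_bounded_variation_on)
next
  case False
  then have "antimono_on {a..b} (\<lambda>q. m powr (- (c / q)))"
    using assms by (auto intro!: monotone_onI powr_mono' divide_left_mono)
  then show ?thesis
    by (rule antimono_on_imp_bounded_variation_on)
qed

section \<open>Power means on a finite measure space\<close>

lemma (in finite_measure) integrable_powr_mono:
  fixes f :: "'a \<Rightarrow> real"
  assumes "f \<in> borel_measurable M" and "\<And>x. 0 \<le> f x" and "0 < s" and "s \<le> t"
    and "integrable M (\<lambda>x. f x powr t)"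
  shows "integrable M (\<lambda>x. f x powr s)"
proof (rule Bochner_Integration.integrable_bound)
  show "integrable M (\<lambda>x. 1 + f x powr t)"
    using assms by simp
  have "f x powr s \<le> 1 + f x powr t" for x
  proof (cases "f x \<le> 1")
    case True
    then have "f x powr s \<le> 1"
      using assms powr_le1[of s "f x"] by auto
    then show ?thesis
      by (smt (verit) powr_ge_zero)
  next
    case False
    then show ?thesis
      using powr_mono[of s t "f x"] \<open>s \<le> t\<close> by linarith
  qed
  then show "AE x in M. norm (f x powr s) \<le> norm (1 + f x powr t)"
    by (smt (verit) AE_I2 powr_ge_zero real_norm_def)
qed (use assms in measurable)

text \<open>Jensen's inequality for the convex function \<open>y \<mapsto> y powr (t / s)\<close> and \<open>y = f x powr s\<close>,
  proved by integrating the tangent line bound at the mean value of \<open>y\<close>.\<close>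

lemma (in finite_measure) power_mean_mono:
  fixes f :: "'a \<Rightarrow> real"
  defines "m \<equiv> measure M (space M)"
  assumes f: "f \<in> borel_measurable M" "\<And>x. 0 \<le> f x" and st: "0 < s" "s \<le> t"
    and int: "integrable M (\<lambda>x. f x powr t)" and m: "0 < m"
  shows "((\<integral>x. f x powr s \<partial>M) / m) powr (1 / s) \<le> ((\<integral>x. f x powr t \<partial>M) / m) powr (1 / t)"
proof (cases "(\<integral>x. f x powr s \<partial>M) = 0")
  case False
  define k where "k = (\<integral>x. f x powr s \<partial>M) / m"
  define r where "r = t / s"
  have r: "1 \<le> r" and sr: "s * r = t"
    using st by (auto simp: r_def)
  have "0 \<le> (\<integral>x. f x powr s \<partial>M)"
    by simp
  with False have "0 < (\<integral>x. f x powr s \<partial>M)"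
    by linarith
  with m have k: "0 < k"
    unfolding k_def by (rule divide_pos_pos[rotated])
  have tangent: "f x powr s / k \<le> f x powr t / (k powr r * r) + (1 - 1 / r)" for x
  proof (cases "f x = 0")
    case False
    then have "0 < f x"
      using f(2)[of x] by simp
    \<comment> \<open>Young's inequality with second factor \<open>1\<close> is the bound \<open>y \<le> y powr r / r + (1 - 1 / r)\<close>,
      which says that \<open>y powr r\<close> lies above its tangent at \<open>y = 1\<close>.\<close>
    have "((f x powr s / k) powr r) powr (1 / r) * 1 powr (1 - 1 / r)
        \<le> 1 / r * (f x powr s / k) powr r + (1 - 1 / r) * 1"
      using r k \<open>0 < f x\<close> by (intro Youngs_inequality_0) auto
    moreover have "(f x powr s / k) powr r = f x powr t / k powr r"
      using k f by (simp add: powr_divide powr_powr sr)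
    moreover have "((f x powr s / k) powr r) powr (1 / r) = f x powr s / k"
      using k r by (simp add: powr_powr)
    ultimately show ?thesis
      by (simp add: mult.commute)
  qed (use r in simp)
  have "(\<integral>x. f x powr s / k \<partial>M) \<le> (\<integral>x. f x powr t / (k powr r * r) + (1 - 1 / r) \<partial>M)"
    using tangent int integrable_powr_mono[OF f st int] by (intro integral_mono) auto
  also have "(\<integral>x. f x powr s / k \<partial>M) = m"
    using k m False by (simp add: k_def)
  also have "(\<integral>x. f x powr t / (k powr r * r) + (1 - 1 / r) \<partial>M)
      = (\<integral>x. f x powr t \<partial>M) / (k powr r * r) + m * (1 - 1 / r)"
    using int by (simp add: m_def)
  finally have "m / r \<le> (\<integral>x. f x powr t \<partial>M) / k powr r / r"
    by (simp add: algebra_simps)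
  then have "m \<le> (\<integral>x. f x powr t \<partial>M) / k powr r"
    using r by (simp add: divide_le_cancel del: divide_divide_eq_left)
  then have "k powr r \<le> (\<integral>x. f x powr t \<partial>M) / m"
    using k m by (simp add: field_simps)
  then have "(k powr r) powr (1 / t) \<le> ((\<integral>x. f x powr t \<partial>M) / m) powr (1 / t)"
    using st by (intro powr_mono2) auto
  moreover have "(k powr r) powr (1 / t) = k powr (1 / s)"
    using st by (simp add: powr_powr r_def)
  ultimately show ?thesis
    by (simp add: k_def)
qed simp

section \<open>The Sobolev constants\<close>

lemma sobolev_quotient_rescaled_antimono:
  fixes \<Omega> :: "'a::euclidean_space set" and u :: "'a \<Rightarrow> real"
  defines "m \<equiv> measure lebesgue \<Omega>"
  assumes \<Omega>: "\<Omega> \<in> lmeasurable" "0 < m" and "0 < s" "s \<le> t" "0 \<le> p" "0 \<le> c"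
    and u: "u \<in> borel_measurable (lebesgue_on \<Omega>)" "\<not> (AE x in lebesgue_on \<Omega>. u x = 0)"
  shows "m powr (p / t) * (c / Lp_norm t \<Omega> u powr p) \<le> m powr (p / s) * (c / Lp_norm s \<Omega> u powr p)"
proof (cases "integrable (lebesgue_on \<Omega>) (\<lambda>x. \<bar>u x\<bar> powr t)")
  case False
  \<comment> \<open>Here the left-hand side is \<open>0\<close>, the quotient by an infinite norm.\<close>
  then show ?thesis
    using \<open>0 \<le> c\<close> by (simp add: Lp_norm_def not_integrable_integral_eq)
next
  case True
  interpret finite_measure "lebesgue_on \<Omega>"
    using \<Omega>(1) by (rule finite_measure_lebesgue_on)
  have m_space: "measure (lebesgue_on \<Omega>) (space (lebesgue_on \<Omega>)) = m"
    using \<Omega> by (simp add: m_def measure_restrict_space fmeasurableD)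
  define S where "S = (\<integral>x. \<bar>u x\<bar> powr s \<partial>lebesgue_on \<Omega>)"
  define T where "T = (\<integral>x. \<bar>u x\<bar> powr t \<partial>lebesgue_on \<Omega>)"
  have abs_u: "(\<lambda>x. \<bar>u x\<bar>) \<in> borel_measurable (lebesgue_on \<Omega>)"
    using u by measurable
  have "integrable (lebesgue_on \<Omega>) (\<lambda>x. \<bar>u x\<bar> powr s)"
    using integrable_powr_mono[OF abs_u _ \<open>0 < s\<close> \<open>s \<le> t\<close> True] by simp
  then have "S \<noteq> 0"
    unfolding S_def using u(2) by (subst integral_nonneg_eq_0_iff_AE) auto
  moreover have "0 \<le> S" "0 \<le> T"
    by (auto simp: S_def T_def)
  ultimately have S: "0 < S"
    by simp
  have mean: "(S / m) powr (1 / s) \<le> (T / m) powr (1 / t)"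
    using power_mean_mono[OF abs_u _ \<open>0 < s\<close> \<open>s \<le> t\<close> True] \<Omega>(2)
    unfolding m_space S_def T_def by simp
  have quotient: "m powr (p / q) * (c / (Q powr (1 / q)) powr p) = c / ((Q / m) powr (1 / q)) powr p"
    if "0 \<le> Q" for q Q
    using that \<Omega>(2) by (simp add: powr_divide powr_powr)
  have pos: "0 < (S / m) powr (1 / s)"
    using S \<Omega>(2) by simp
  have "c / ((T / m) powr (1 / t)) powr p \<le> c / ((S / m) powr (1 / s)) powr p"
  proof (rule divide_left_mono)
    show "((S / m) powr (1 / s)) powr p \<le> ((T / m) powr (1 / t)) powr p"
      using mean \<open>0 \<le> p\<close> by (intro powr_mono2) auto
    show "0 < ((T / m) powr (1 / t)) powr p * ((S / m) powr (1 / s)) powr p"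
      using less_le_trans[OF pos mean] pos by (intro mult_pos_pos) auto
  qed fact
  then show ?thesis
    using quotient[OF \<open>0 \<le> S\<close>] quotient[OF \<open>0 \<le> T\<close>] by (simp add: Lp_norm_def S_def T_def)
qed

text \<open>Multiplication by a positive constant commutes with the infimum, so the monotonicity of the
  rescaled quotients passes to \<open>\<lambda>\<^sub>q\<close>.\<close>

lemma sobolev_const_rescaled_antimono:
  fixes \<Omega> :: "'a::euclidean_space set"
  defines "m \<equiv> measure lebesgue \<Omega>"
  assumes \<Omega>: "\<Omega> \<in> lmeasurable" "0 < m" and st: "0 < s" "s \<le> t" and "0 \<le> p"
    and nonempty: "{u \<in> W01p p \<Omega>. \<not> (AE x in lebesgue_on \<Omega>. u x = 0)} \<noteq> {}"
  shows "m powr (p / t) * sobolev_const p \<Omega> t \<le> m powr (p / s) * sobolev_const p \<Omega> s"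
proof -
  define K where "K = {u \<in> W01p p \<Omega>. \<not> (AE x in lebesgue_on \<Omega>. u x = 0)}"
  define R where "R q u = Lp_norm p \<Omega> (weak_gradient \<Omega> u) powr p / Lp_norm q \<Omega> u powr p" for q u
  have const: "sobolev_const p \<Omega> q = (INF u\<in>K. R q u)" for q
    by (simp add: sobolev_const_def K_def R_def)
  have quotient: "m powr (p / t) * R t u \<le> m powr (p / s) * R s u" if "u \<in> K" for u
  proof -
    have "u \<in> borel_measurable (lebesgue_on \<Omega>)" "\<not> (AE x in lebesgue_on \<Omega>. u x = 0)"
      using that by (auto simp: K_def W01p_def W1p_def Lp_space_def)
    then show ?thesis
      unfolding R_def m_def
      using \<Omega> st \<open>0 \<le> p\<close> by (intro sobolev_quotient_rescaled_antimono) (auto simp: m_def)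
  qed
  have "bdd_below (R t ` K)"
    by (auto simp: R_def intro!: bdd_belowI[of _ 0])
  then have inf_le: "(INF u\<in>K. R t u) \<le> R t u" if "u \<in> K" for u
    using that by (rule cINF_lower)
  have "m powr (p / t) * (INF u\<in>K. R t u) / m powr (p / s) \<le> (INF u\<in>K. R s u)"
  proof (rule cINF_greatest)
    show "K \<noteq> {}"
      using nonempty by (simp add: K_def)
    fix u assume u: "u \<in> K"
    have "m powr (p / t) * (INF u\<in>K. R t u) \<le> m powr (p / t) * R t u"
      using inf_le[OF u] by (intro mult_left_mono) auto
    also have "\<dots> \<le> m powr (p / s) * R s u"
      by (rule quotient[OF u])
    finally show "m powr (p / t) * (INF u\<in>K. R t u) / m powr (p / s) \<le> R s u"
      using \<Omega>(2) by (simp add: field_simps)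
  qed
  then show ?thesis
    using \<Omega>(2) by (simp add: const field_simps)
qed

theorem corollary3:
  fixes \<Omega> :: "'a::euclidean_space set" and p :: real
  assumes "2 \<le> DIM('a)"
    and "1 < p" and "p < real DIM('a)"
    and "smooth_bounded_domain \<Omega>"
  shows "bounded_variation_on (sobolev_const p \<Omega>)
           {1 .. real DIM('a) * p / (real DIM('a) - p)}"
proof -
  define b where "b = real DIM('a) * p / (real DIM('a) - p)"
  define m where "m = measure lebesgue \<Omega>"
  have "open \<Omega>" "\<Omega> \<noteq> {}" "bounded \<Omega>"
    using assms(4) by (auto simp: smooth_bounded_domain_def)
  then have \<Omega>: "\<Omega> \<in> lmeasurable" and "\<not> negligible \<Omega>"
    by (auto intro: lmeasurable_open dest: open_not_negligible)
  then have m: "0 < m"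
    by (simp add: m_def negligible_iff_measure0 zero_less_measure_iff less_le)
  have "bounded_variation_on (sobolev_const p \<Omega>) {1..b}"
  proof (cases "{u \<in> W01p p \<Omega>. \<not> (AE x in lebesgue_on \<Omega>. u x = 0)} = {}")
    case True
    \<comment> \<open>The infimum of the empty set is a real number that does not depend on \<open>q\<close>.\<close>
    have "sobolev_const p \<Omega> = (\<lambda>q. Inf {})"
      unfolding sobolev_const_def True by simp
    then show ?thesis
      by (auto simp: bounded_variation_on_def)
  next
    case False
    have "antimono_on {1..b} (\<lambda>q. m powr (p / q) * sobolev_const p \<Omega> q)"
      using sobolev_const_rescaled_antimono[OF \<Omega> _ _ _ _ False] m assms(2)
      by (auto simp: m_def intro!: monotone_onI)
    then have "bounded_variation_on (\<lambda>q. m powr (p / q) * sobolev_const p \<Omega> q) {1..b}"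
      by (rule antimono_on_imp_bounded_variation_on)
    moreover have "bounded_variation_on (\<lambda>q. m powr (- (p / q))) {1..b}"
      using m assms(2) by (intro bounded_variation_on_powr_inverse) auto
    ultimately have "bounded_variation_on
        (\<lambda>q. m powr (- (p / q)) * (m powr (p / q) * sobolev_const p \<Omega> q)) {1..b}"
      by (rule bounded_variation_on_mult[rotated])
    moreover have "m powr (- (p / q)) * (m powr (p / q) * sobolev_const p \<Omega> q) = sobolev_const p \<Omega> q"
      for q
      using m by (simp add: powr_minus)
    ultimately show ?thesis
      by simp
  qed
  then show ?thesis
    by (simp add: b_def)
qed

end
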